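(* Let $n\ge2$ and $\tau_i=(c_i,d_i,p_i,J_i)$, $i=1,\dots,n$, nonnegative integers with $c_i\ge1$, $p_i\ge1$, $c_i\le d_i\le p_i$, $0\le J_i\le p_i$, and $\sum_{i<n}c_i/p_i<1$. Let $I\subseteq\{1,\dots,n-1\}$, $\gamma\in\mathbb{Z}_{\ge1}$ and let $k$ be an integer with $k\ge S$, where $S$ is the largest value of $s$ among all optimal solutions $(s,x)$ of \[ \mathcal{M}(I,k)=\min\Big\{s+\sum_{i\in I}c_ix_i : s+p_ix_i\ge k+J_i\ \forall i\in I,\ s\in\mathbb{Z}_{\ge0},\ x\in\mathbb{Z}^I\Big\}. \] Let $\mathcal{R}(I,\gamma)=\min\{t\in\mathbb{Z}_{\ge0}: t\ge \gamma+\sum_{i\in I}c_i\lceil (t+J_i)/p_i\rceil\}$. Then $\mathcal{R}(I,\gamma)\le k$ if and only if $\mathcal{M}(I,k)\le k-\gamma$; in particular the decision problem $\mathcal{R}(I,\gamma)\le_? k$ reduces in constant time to the decision problem $\mathcal{M}(I,k)\le_? k-\gamma$.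
   Context: $\mathcal{M}(I,k)$ is an instance of the Mixing Set problem. $\mathcal{R}(I,\gamma)$ generalizes the worst-case response time $r_n=\mathcal{R}(\{1,\dots,n-1\},c_n)$. *)

theory Defs
  imports Complex_Main "HOL-Library.FuncSet"
begin

datatype task =
  Task (wcet: int) (deadline: int) (period: int) (jitter: int)

text \<open>
  For a task system and \<open>I \<subseteq> {1..n - 1}\<close>, the utilization bound makes the extrema below
  (\<open>LEAST\<close> and \<open>GREATEST\<close>) exist.
\<close>

definition task_system :: "nat \<Rightarrow> (nat \<Rightarrow> task) \<Rightarrow> bool" where
  "task_system n \<tau> \<longleftrightarrow>
     2 \<le> n \<and>
     (\<forall>i\<in>{1..n}. 1 \<le> wcet (\<tau> i) \<and> 1 \<le> period (\<tau> i) \<and>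
        wcet (\<tau> i) \<le> deadline (\<tau> i) \<and> deadline (\<tau> i) \<le> period (\<tau> i) \<and>
        0 \<le> jitter (\<tau> i) \<and> jitter (\<tau> i) \<le> period (\<tau> i)) \<and>
     (\<Sum>i\<in>{1..<n}. real_of_int (wcet (\<tau> i)) / real_of_int (period (\<tau> i))) < 1"

definition response_time :: "(nat \<Rightarrow> task) \<Rightarrow> nat set \<Rightarrow> int \<Rightarrow> int" where
  "response_time \<tau> I \<gamma> =
     (LEAST t. 0 \<le> t \<and>
        t \<ge> \<gamma> + (\<Sum>i\<in>I. wcet (\<tau> i) *
          \<lceil>real_of_int (t + jitter (\<tau> i)) / real_of_int (period (\<tau> i))\<rceil>))"

definition mixing_feasible :: "(nat \<Rightarrow> task) \<Rightarrow> nat set \<Rightarrow> int \<Rightarrow> (int \<times> (nat \<Rightarrow> int)) set" where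
  "mixing_feasible \<tau> I k =
     {(s, x). 0 \<le> s \<and> x \<in> I \<rightarrow>\<^sub>E UNIV \<and>
        (\<forall>i\<in>I. s + period (\<tau> i) * x i \<ge> k + jitter (\<tau> i))}"

definition mixing_objective :: "(nat \<Rightarrow> task) \<Rightarrow> nat set \<Rightarrow> int \<times> (nat \<Rightarrow> int) \<Rightarrow> int" where
  "mixing_objective \<tau> I = (\<lambda>(s, x). s + (\<Sum>i\<in>I. wcet (\<tau> i) * x i))"

definition mixing_value :: "(nat \<Rightarrow> task) \<Rightarrow> nat set \<Rightarrow> int \<Rightarrow> int" where
  "mixing_value \<tau> I k = (LEAST v. v \<in> mixing_objective \<tau> I ` mixing_feasible \<tau> I k)"

definition mixing_optimal :: "(nat \<Rightarrow> task) \<Rightarrow> nat set \<Rightarrow> int \<Rightarrow> (int \<times> (nat \<Rightarrow> int)) set" where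
  "mixing_optimal \<tau> I k =
     {z \<in> mixing_feasible \<tau> I k.
        \<forall>z'\<in>mixing_feasible \<tau> I k. mixing_objective \<tau> I z \<le> mixing_objective \<tau> I z'}"

definition mixing_max_s :: "(nat \<Rightarrow> task) \<Rightarrow> nat set \<Rightarrow> int \<Rightarrow> int" where
  "mixing_max_s \<tau> I k = (GREATEST s. s \<in> fst ` mixing_optimal \<tau> I k)"

text \<open>
  Constant time is measured on a unit-cost random access machine over the integers. The
  instruction set has no multiplication or division. An instance is transformed in place:
  since instances have unbounded size, constant time only makes sense when the unchanged part
  of an instance need not be copied.
\<close>

type_synonym memory = "nat \<Rightarrow> int"

datatype instr =
    Const nat int
  | Add nat nat nat
  | Sub nat nat nat
  | Load nat nat
  | Store nat nat
  | JumpPos nat nat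

type_synonym config = "nat \<times> memory"

fun exec :: "instr \<Rightarrow> config \<Rightarrow> config" where
  "exec (Const a v) (pc, m) = (Suc pc, m(a := v))"
| "exec (Add a b c) (pc, m) = (Suc pc, m(a := m b + m c))"
| "exec (Sub a b c) (pc, m) = (Suc pc, m(a := m b - m c))"
| "exec (Load a b) (pc, m) = (Suc pc, m(a := m (nat (m b))))"
| "exec (Store a b) (pc, m) = (Suc pc, m(nat (m a) := m b))"
| "exec (JumpPos a l) (pc, m) = (if 0 < m a then l else Suc pc, m)"

text \<open>The machine halts when the program counter leaves the program.\<close>

definition step :: "instr list \<Rightarrow> config \<Rightarrow> config" where
  "step P cf = (if fst cf < length P then exec (P ! fst cf) cf else cf)"

definition transforms_within :: "instr list \<Rightarrow> nat \<Rightarrow> memory \<Rightarrow> memory \<Rightarrow> bool" where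
  "transforms_within P T m m' \<longleftrightarrow>
     (\<exists>pc. (step P ^^ T) (0, m) = (pc, m') \<and> length P \<le> pc)"

text \<open>
  A decision problem with a promise: \<open>instances\<close> are the admissible inputs, and
  \<open>encoded x m\<close> says that the memory \<open>m\<close> holds the instance \<open>x\<close>.
\<close>

record 'a decision_problem =
  encoded :: "'a \<Rightarrow> memory \<Rightarrow> bool"
  instances :: "'a set"
  yes_instance :: "'a \<Rightarrow> bool"

definition constant_time_reducible :: "'a decision_problem \<Rightarrow> 'b decision_problem \<Rightarrow> bool" where
  "constant_time_reducible A B \<longleftrightarrow>
     (\<exists>f P T. \<forall>x\<in>instances A.
        f x \<in> instances B \<and>
        (yes_instance A x \<longleftrightarrow> yes_instance B (f x)) \<and>
        (\<forall>m. encoded A x m \<longrightarrow> (\<exists>m'. transforms_within P T m m' \<and> encoded B (f x) m')))"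

text \<open>
  An instance of either problem is \<open>(n, \<tau>, I, k, b)\<close>, where \<open>b\<close> is \<open>\<gamma>\<close> in the question
  \<open>response_time \<tau> I \<gamma> \<le> k\<close> and the threshold in the question
  \<open>mixing_value \<tau> I k \<le> b\<close>. Both use the same encoding, in which the membership of \<open>i\<close> in
  \<open>I\<close> is a flag next to the parameters of \<open>\<tau> i\<close>; the addresses 3 and 4 are unused.
\<close>

type_synonym task_instance = "nat \<times> (nat \<Rightarrow> task) \<times> nat set \<times> int \<times> int"

fun task_encoded :: "task_instance \<Rightarrow> memory \<Rightarrow> bool" where
  "task_encoded (n, \<tau>, I, k, b) m \<longleftrightarrow>
     m 0 = int n \<and> m 1 = k \<and> m 2 = b \<and>
     (\<forall>i\<in>{1..n}.
        m (5 * i) = wcet (\<tau> i) \<and> m (5 * i + 1) = deadline (\<tau> i) \<and>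
        m (5 * i + 2) = period (\<tau> i) \<and> m (5 * i + 3) = jitter (\<tau> i) \<and>
        m (5 * i + 4) = (if i \<in> I then 1 else 0))"

definition response_time_problem :: "task_instance decision_problem" where
  "response_time_problem =
     \<lparr>encoded = task_encoded,
      instances = {(n, \<tau>, I, k, \<gamma>). task_system n \<tau> \<and> I \<subseteq> {1..n - 1} \<and> 1 \<le> \<gamma> \<and>
                     mixing_max_s \<tau> I k \<le> k},
      yes_instance = (\<lambda>(n, \<tau>, I, k, \<gamma>). response_time \<tau> I \<gamma> \<le> k)\<rparr>"

definition mixing_problem :: "task_instance decision_problem" where
  "mixing_problem =
     \<lparr>encoded = task_encoded,
      instances = {(n, \<tau>, I, k, b). task_system n \<tau> \<and> I \<subseteq> {1..n - 1}},
      yes_instance = (\<lambda>(n, \<tau>, I, k, b). mixing_value \<tau> I k \<le> b)\<rparr>"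

end

theory Submission
  imports Defs
begin

text \<open>
  For fixed \<open>s\<close> the best choice in the mixing set is \<open>x i = \<lceil>(k - s + J i) / p i\<rceil>\<close>, so
  substituting \<open>t = k - s\<close> turns \<open>M(I,k) \<le> k - \<gamma>\<close> into the existence of some \<open>t \<le> k\<close> with
  \<open>\<gamma> + (\<Sum>i\<in>I. c i * \<lceil>(t + J i) / p i\<rceil>) \<le> t\<close>. This is \<open>R(I,\<gamma>) \<le> k\<close> except for the
  constraint \<open>t \<ge> 0\<close>, that is \<open>s \<le> k\<close>, which the hypothesis on the largest optimal \<open>s\<close>
  provides. The reduction only replaces \<open>\<gamma>\<close> by \<open>k - \<gamma>\<close>.
\<close>

text \<open>The order on \<open>int\<close> is not well-founded, so \<open>LEAST\<close> is
  meaningful only once a minimum exists. A lower bound \<open>b\<close> provides one: minimizing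
  \<open>nat (x - b)\<close> transfers the question to the naturals.\<close>

lemma int_Least:
  fixes P :: "int \<Rightarrow> bool"
  assumes "P a" and "\<And>x. P x \<Longrightarrow> b \<le> x"
  shows "P (LEAST x. P x)" and "\<And>x. P x \<Longrightarrow> (LEAST x. P x) \<le> x"
proof -
  obtain y where "P y" and "\<And>z. P z \<Longrightarrow> nat (y - b) \<le> nat (z - b)"
    using ex_has_least_nat[of P a "\<lambda>x. nat (x - b)"] \<open>P a\<close> by blast
  then have y: "P y" "\<And>z. P z \<Longrightarrow> y \<le> z"
    using assms(2) by (force simp: nat_le_eq_zle)+
  then have "(LEAST x. P x) = y" by (intro Least_equality)
  with y show "P (LEAST x. P x)" "\<And>x. P x \<Longrightarrow> (LEAST x. P x) \<le> x" by simp_all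
qed

lemma int_le_Greatest:
  fixes P :: "int \<Rightarrow> bool"
  assumes "P a" and "\<And>x. P x \<Longrightarrow> x \<le> b"
  shows "a \<le> (GREATEST x. P x)"
proof -
  obtain y where "P y" and "\<And>z. P z \<Longrightarrow> nat (b - y) \<le> nat (b - z)"
    using ex_has_least_nat[of P a "\<lambda>x. nat (b - x)"] \<open>P a\<close> by blast
  then have y: "P y" "\<And>z. P z \<Longrightarrow> z \<le> y"
    using assms(2) by (force simp: nat_le_eq_zle)+
  then have "(GREATEST x. P x) = y" by (intro Greatest_equality)
  with y \<open>P a\<close> show ?thesis by simp
qed

definition utilization :: "(nat \<Rightarrow> task) \<Rightarrow> nat set \<Rightarrow> real" where
  "utilization \<tau> I = (\<Sum>i\<in>I. wcet (\<tau> i) / period (\<tau> i))"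

text \<open>This is the request bound function with release jitter. The argument ranges over all
  integers, since \<open>t = k - s\<close> is negative when \<open>s > k\<close>.\<close>

definition demand :: "(nat \<Rightarrow> task) \<Rightarrow> nat set \<Rightarrow> int \<Rightarrow> int" where
  "demand \<tau> I t = (\<Sum>i\<in>I. wcet (\<tau> i) *
     \<lceil>real_of_int (t + jitter (\<tau> i)) / real_of_int (period (\<tau> i))\<rceil>)"

locale subsystem =
  fixes \<tau> :: "nat \<Rightarrow> task" and I :: "nat set"
  assumes finite_I: "finite I"
    and wcet_pos: "i \<in> I \<Longrightarrow> 0 < wcet (\<tau> i)"
    and period_pos: "i \<in> I \<Longrightarrow> 0 < period (\<tau> i)"
    and jitter_nonneg: "i \<in> I \<Longrightarrow> 0 \<le> jitter (\<tau> i)"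
    and utilization_less_1: "utilization \<tau> I < 1"

lemma task_system_subsystem:
  assumes "task_system n \<tau>" and "I \<subseteq> {1..n - 1}"
  shows "subsystem \<tau> I"
proof
  have *: "1 \<le> wcet (\<tau> i)" "1 \<le> period (\<tau> i)" "0 \<le> jitter (\<tau> i)" if "i \<in> {1..n}" for i
    using assms(1) that unfolding task_system_def by blast+
  have sub: "I \<subseteq> {1..<n}" "I \<subseteq> {1..n}" using assms(2) by force+
  show "finite I" using assms(2) finite_subset by blast
  show "0 < wcet (\<tau> i)" "0 < period (\<tau> i)" "0 \<le> jitter (\<tau> i)" if "i \<in> I" for i
    using *[of i] that sub by force+
  have "utilization \<tau> I \<le> utilization \<tau> {1..<n}"
    unfolding utilization_def
  proof (intro sum_mono2)
    fix i assume "i \<in> {1..<n} - I"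
    then show "0 \<le> real_of_int (wcet (\<tau> i)) / real_of_int (period (\<tau> i))"
      using *[of i] by simp
  qed (use sub in auto)
  also have "\<dots> < 1" using assms(1) by (simp add: task_system_def utilization_def)
  finally show "utilization \<tau> I < 1" .
qed

context subsystem
begin

text \<open>A ceiling exceeds its argument by at most 1, so \<open>demand\<close> lies below a line
  whose slope \<open>utilization \<tau> I\<close> is less than 1.\<close>

lemma demand_le:
  "real_of_int (demand \<tau> I t) \<le>
     t * utilization \<tau> I + (\<Sum>i\<in>I. wcet (\<tau> i) * (jitter (\<tau> i) / period (\<tau> i) + 1))"
proof -
  have "real_of_int (demand \<tau> I t) \<le>
      (\<Sum>i\<in>I. wcet (\<tau> i) * ((t + jitter (\<tau> i)) / period (\<tau> i) + 1))"
    unfolding demand_def of_int_sum of_int_mult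
    using wcet_pos by (intro sum_mono mult_left_mono) (auto simp: less_imp_le of_int_ceiling_le_add_one simp del: of_int_add)
  also have "\<dots> = t * utilization \<tau> I + (\<Sum>i\<in>I. wcet (\<tau> i) * (jitter (\<tau> i) / period (\<tau> i) + 1))"
    unfolding utilization_def sum_distrib_left sum.distrib[symmetric]
    by (intro sum.cong) (simp_all add: algebra_simps add_divide_distrib)
  finally show ?thesis .
qed

lemma exists_demand_le: "\<exists>t\<ge>0. \<gamma> + demand \<tau> I t \<le> t"
proof -
  define C where "C = \<gamma> + (\<Sum>i\<in>I. wcet (\<tau> i) * (jitter (\<tau> i) / period (\<tau> i) + 1))"
  \<comment> \<open>The quotient solves \<open>C + t * utilization \<tau> I = t\<close>, the point
    where the upper line for \<open>\<gamma> + demand\<close> meets the diagonal.\<close>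
  define t where "t = max 0 \<lceil>C / (1 - utilization \<tau> I)\<rceil>"
  have "C / (1 - utilization \<tau> I) \<le> t" unfolding t_def by linarith
  then have "C \<le> t * (1 - utilization \<tau> I)"
    using utilization_less_1 by (simp add: divide_le_eq)
  then have "\<gamma> + real_of_int (demand \<tau> I t) \<le> t"
    using demand_le[of t] by (simp add: C_def algebra_simps)
  then have "\<gamma> + demand \<tau> I t \<le> t" by linarith
  moreover have "0 \<le> t" by (simp add: t_def)
  ultimately show ?thesis by blast
qed

text \<open>By \<open>exists_demand_le\<close> the minimum defining \<open>response_time\<close> is
  attained, so it is itself a witness \<open>t\<close> and lies below every other one.\<close>

lemma response_time_le_iff:
  "response_time \<tau> I \<gamma> \<le> k \<longleftrightarrow> (\<exists>t. 0 \<le> t \<and> t \<le> k \<and> \<gamma> + demand \<tau> I t \<le> t)"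
proof -
  define P where "P t \<longleftrightarrow> 0 \<le> t \<and> \<gamma> + demand \<tau> I t \<le> t" for t
  obtain a where "P a" using exists_demand_le[of \<gamma>] by (auto simp: P_def)
  have "response_time \<tau> I \<gamma> = (LEAST t. P t)"
    by (simp add: response_time_def P_def demand_def)
  moreover have "P (LEAST t. P t)" "\<And>t. P t \<Longrightarrow> (LEAST t. P t) \<le> t"
    using int_Least[of P a 0] \<open>P a\<close> by (auto simp: P_def)
  ultimately show ?thesis unfolding P_def by (metis order_trans)
qed

text \<open>Each constraint bounds the integer \<open>x i\<close> below by a quotient, hence by its
  ceiling, and the positive weights \<open>wcet\<close> preserve this under summation.\<close>

lemma objective_ge:
  assumes "(s, x) \<in> mixing_feasible \<tau> I k"
  shows "s + demand \<tau> I (k - s) \<le> mixing_objective \<tau> I (s, x)"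
proof -
  have "\<lceil>real_of_int (k - s + jitter (\<tau> i)) / real_of_int (period (\<tau> i))\<rceil> \<le> x i"
    if "i \<in> I" for i
  proof -
    have "k - s + jitter (\<tau> i) \<le> x i * period (\<tau> i)"
      using assms that by (auto simp: mixing_feasible_def algebra_simps)
    then have "real_of_int (k - s + jitter (\<tau> i)) \<le> x i * period (\<tau> i)"
      by (metis of_int_le_iff of_int_mult)
    then show ?thesis
      using period_pos[OF that] by (simp add: ceiling_le_iff divide_le_eq)
  qed
  then show ?thesis
    unfolding mixing_objective_def demand_def
    using wcet_pos by (auto intro!: sum_mono mult_left_mono simp: less_imp_le)
qed

lemma objective_attained:
  assumes "0 \<le> s"
  shows "\<exists>x. (s, x) \<in> mixing_feasible \<tau> I k \<and>
           mixing_objective \<tau> I (s, x) = s + demand \<tau> I (k - s)"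
proof -
  \<comment> \<open>The lambda is restricted to \<open>I\<close> because feasible vectors must be
    extensional.\<close>
  define x where "x = (\<lambda>i\<in>I. \<lceil>real_of_int (k - s + jitter (\<tau> i)) / real_of_int (period (\<tau> i))\<rceil>)"
  have "k + jitter (\<tau> i) \<le> s + period (\<tau> i) * x i" if "i \<in> I" for i
  proof -
    have "real_of_int (k - s + jitter (\<tau> i)) / period (\<tau> i) \<le> x i"
      using that by (simp add: x_def)
    then have "real_of_int (k - s + jitter (\<tau> i)) \<le> x i * period (\<tau> i)"
      using period_pos[OF that] by (simp add: divide_le_eq)
    then have "k - s + jitter (\<tau> i) \<le> x i * period (\<tau> i)"
      by (metis of_int_le_iff of_int_mult)
    then show ?thesis by (simp add: algebra_simps)
  qed
  then have "(s, x) \<in> mixing_feasible \<tau> I k"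
    using assms by (auto simp: mixing_feasible_def x_def)
  moreover have "mixing_objective \<tau> I (s, x) = s + demand \<tau> I (k - s)"
    by (simp add: mixing_objective_def demand_def x_def)
  ultimately show ?thesis by blast
qed

text \<open>Dropping the nonnegative jitter and the rounding can only decrease each term, whatever
  the sign of \<open>t\<close>.\<close>

lemma demand_ge: "t * utilization \<tau> I \<le> real_of_int (demand \<tau> I t)"
  unfolding utilization_def sum_distrib_left demand_def of_int_sum of_int_mult
proof (intro sum_mono)
  fix i assume "i \<in> I"
  then have "t / real_of_int (period (\<tau> i)) \<le> (t + jitter (\<tau> i)) / real_of_int (period (\<tau> i))"
    using period_pos jitter_nonneg by (intro divide_right_mono) (auto simp: less_imp_le)
  also have "\<dots> \<le> \<lceil>real_of_int (t + jitter (\<tau> i)) / real_of_int (period (\<tau> i))\<rceil>"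
    by simp
  finally show "t * (real_of_int (wcet (\<tau> i)) / real_of_int (period (\<tau> i))) \<le>
      real_of_int (wcet (\<tau> i)) *
      \<lceil>real_of_int (t + jitter (\<tau> i)) / real_of_int (period (\<tau> i))\<rceil>"
    using mult_left_mono[of _ _ "real_of_int (wcet (\<tau> i))"] wcet_pos[OF \<open>i \<in> I\<close>]
    by (fastforce simp: algebra_simps)
qed

text \<open>At \<open>t = k - s\<close>, \<open>demand_ge\<close> makes the objective grow at least
  linearly in \<open>s\<close>, with positive slope. This bounds the objective below and the optimal
  \<open>s\<close> above, so both extrema exist.\<close>

lemma objective_bound:
  assumes "(s, x) \<in> mixing_feasible \<tau> I k"
  shows "s * (1 - utilization \<tau> I) + k * utilization \<tau> I \<le> mixing_objective \<tau> I (s, x)"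
  using demand_ge[of "k - s"] objective_ge[OF assms] by (simp add: algebra_simps)

lemma mixing_value_attained:
  "mixing_value \<tau> I k \<in> mixing_objective \<tau> I ` mixing_feasible \<tau> I k"
  "z \<in> mixing_feasible \<tau> I k \<Longrightarrow> mixing_value \<tau> I k \<le> mixing_objective \<tau> I z"
proof -
  let ?V = "mixing_objective \<tau> I ` mixing_feasible \<tau> I k"
  obtain a where a: "a \<in> ?V"
    using objective_attained[of 0 k] by blast
  \<comment> \<open>The floor turns the real lower bound at \<open>s = 0\<close> into the integer
    one that \<open>int_Least\<close> requires.\<close>
  have b: "\<lfloor>k * utilization \<tau> I\<rfloor> \<le> v" if v: "v \<in> ?V" for v
  proof -
    obtain s x where "(s, x) \<in> mixing_feasible \<tau> I k" "v = mixing_objective \<tau> I (s, x)"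
      using v by auto
    moreover from this have "0 \<le> s * (1 - utilization \<tau> I)"
      using utilization_less_1 by (auto simp: mixing_feasible_def)
    ultimately show ?thesis using objective_bound[of s x k] by linarith
  qed
  show "mixing_value \<tau> I k \<in> ?V"
    unfolding mixing_value_def by (rule int_Least(1)[of "\<lambda>v. v \<in> ?V", OF a b])
  show "z \<in> mixing_feasible \<tau> I k \<Longrightarrow> mixing_value \<tau> I k \<le> mixing_objective \<tau> I z"
    unfolding mixing_value_def by (rule int_Least(2)[of "\<lambda>v. v \<in> ?V", OF a b]) auto
qed

text \<open>All optimal solutions share one objective value, so dividing
  \<open>objective_bound\<close> by its slope bounds every optimal \<open>s\<close>, and
  \<open>GREATEST\<close> is a true maximum.\<close>

lemma optimal_le_mixing_max_s:
  assumes "(s, x) \<in> mixing_optimal \<tau> I k"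
  shows "s \<le> mixing_max_s \<tau> I k"
  unfolding mixing_max_s_def
proof (rule int_le_Greatest)
  show "s \<in> fst ` mixing_optimal \<tau> I k" using assms by force
next
  fix s' assume "s' \<in> fst ` mixing_optimal \<tau> I k"
  then obtain x' where "(s', x') \<in> mixing_optimal \<tau> I k" by auto
  then have "(s', x') \<in> mixing_feasible \<tau> I k"
    "mixing_objective \<tau> I (s', x') \<le> mixing_objective \<tau> I (s, x)"
    using assms by (auto simp: mixing_optimal_def)
  then have "s' * (1 - utilization \<tau> I) \<le> mixing_objective \<tau> I (s, x) - k * utilization \<tau> I"
    using objective_bound[of s' x' k] by linarith
  then have "s' \<le> (mixing_objective \<tau> I (s, x) - k * utilization \<tau> I) / (1 - utilization \<tau> I)"
    using utilization_less_1 by (simp add: le_divide_eq)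
  then show "s' \<le> \<lfloor>(mixing_objective \<tau> I (s, x) - k * utilization \<tau> I) / (1 - utilization \<tau> I)\<rfloor>"
    by linarith
qed

lemma response_time_le_iff_mixing_value_le:
  assumes "mixing_max_s \<tau> I k \<le> k"
  shows "response_time \<tau> I \<gamma> \<le> k \<longleftrightarrow> mixing_value \<tau> I k \<le> k - \<gamma>"
proof
  assume "response_time \<tau> I \<gamma> \<le> k"
  then obtain t where t: "0 \<le> t" "t \<le> k" "\<gamma> + demand \<tau> I t \<le> t"
    by (auto simp: response_time_le_iff)
  \<comment> \<open>Here \<open>t \<le> k\<close> makes \<open>k - t\<close> an admissible value of
    \<open>s\<close>.\<close>
  obtain x where x: "(k - t, x) \<in> mixing_feasible \<tau> I k"
    "mixing_objective \<tau> I (k - t, x) = k - t + demand \<tau> I t"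
    using objective_attained[of "k - t" k] t by auto
  show "mixing_value \<tau> I k \<le> k - \<gamma>"
    using mixing_value_attained(2)[OF x(1)] x(2) t(3) by linarith
next
  assume le: "mixing_value \<tau> I k \<le> k - \<gamma>"
  obtain s x where sx: "(s, x) \<in> mixing_feasible \<tau> I k"
    "mixing_value \<tau> I k = mixing_objective \<tau> I (s, x)"
    using mixing_value_attained(1)[of k] by auto
  then have "(s, x) \<in> mixing_optimal \<tau> I k"
    using mixing_value_attained(2)[of _ k] by (simp add: mixing_optimal_def)
  then have "s \<le> k" using optimal_le_mixing_max_s assms order_trans by blast
  moreover have "0 \<le> s" using sx by (simp add: mixing_feasible_def)
  \<comment> \<open>The term \<open>s\<close> of the objective moves to the right-hand side, so
    \<open>k - s\<close> is a witness for the response time.\<close>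
  moreover have "\<gamma> + demand \<tau> I (k - s) \<le> k - s"
    using objective_ge[OF sx(1)] sx(2) le by linarith
  ultimately show "response_time \<tau> I \<gamma> \<le> k"
    unfolding response_time_le_iff by (intro exI[of _ "k - s"]) simp
qed

end

lemma constant_time_reducible_response_time_mixing:
  "constant_time_reducible response_time_problem mixing_problem"
  unfolding constant_time_reducible_def
proof (intro exI ballI conjI allI impI)
  let ?f = "\<lambda>(n, \<tau>, I, k, \<gamma>). (n, \<tau>, I, k, k - \<gamma>)"
  fix x assume x: "x \<in> instances response_time_problem"
  obtain n \<tau> I k \<gamma> where x_eq: "x = (n, \<tau>, I, k, \<gamma>)" by (cases x)
  have inst: "task_system n \<tau>" "I \<subseteq> {1..n - 1}" "mixing_max_s \<tau> I k \<le> k"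
    using x by (simp_all add: x_eq response_time_problem_def)
  show "?f x \<in> instances mixing_problem"
    using inst by (simp add: x_eq mixing_problem_def)
  show "yes_instance response_time_problem x = yes_instance mixing_problem (?f x)"
    using subsystem.response_time_le_iff_mixing_value_le[OF task_system_subsystem] inst
    by (simp add: x_eq mixing_problem_def response_time_problem_def)
  fix m assume "encoded response_time_problem x m"
  \<comment> \<open>One subtraction overwrites cell 2 with \<open>k - \<gamma>\<close> and moves the
    counter to 1, the program length, so the machine halts. Task data start at address 5 and stay
    intact.\<close>
  then show "transforms_within [Sub 2 1 2] 1 m (m(2 := m 1 - m 2))"
    and "encoded mixing_problem (?f x) (m(2 := m 1 - m 2))"
    by (auto simp: x_eq transforms_within_def step_def mixing_problem_def response_time_problem_def)
qed

theorem theorem9: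
  fixes n :: nat and \<tau> :: "nat \<Rightarrow> task" and I :: "nat set" and \<gamma> k :: int
  assumes "task_system n \<tau>"
    and "I \<subseteq> {1..n - 1}"
    and "1 \<le> \<gamma>"
    and "mixing_max_s \<tau> I k \<le> k"
  shows "(response_time \<tau> I \<gamma> \<le> k \<longleftrightarrow> mixing_value \<tau> I k \<le> k - \<gamma>) \<and>
         constant_time_reducible response_time_problem mixing_problem"
  using subsystem.response_time_le_iff_mixing_value_le[OF task_system_subsystem] assms
    constant_time_reducible_response_time_mixing by blast

end
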